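(* Let $n \geq 2$ be an integer and let $R$ be a tournament on $[n]$. Then there exists an $n$ partition $\mathcal{A} = \{A_1, \dots, A_n\}$ of $[3^{n-2} n]$ such that $R = R[\mathcal{A}]$. In particular, $N_n \leq 3^{n-2}$.
   Context: For a positive integer $m$, $[m] = \{1, \dots, m\}$, and $|X|$ is the cardinality of a finite set $X$. A digraph on a nonempty finite set $I$ is a subset $R \subset I \times I$ with $R \cap R^{-1} = \emptyset$, where $R^{-1} = \{(j,i) : (i,j) \in R\}$ (so in particular $R$ contains no pair $(i,i)$). A tournament on $I$ is a digraph $R$ on $I$ such that for every pair of distinct $i, j \in I$ exactly one of $(i,j), (j,i)$ lies in $R$. For positive integers $n, N$, an $n$ partition of $[Nn]$ is an indexed family $\mathcal{A} = \{A_1, \dots, A_n\}$ of pairwise disjoint subsets of $[Nn]$ with union $[Nn]$ and $|A_i| = N$ for all $i$. Its digraph on $[n]$ is $R[\mathcal{A}] = \{(i,j) \in [n] \times [n] : |\{(a,b) \in A_i \times A_j : a > b\}| > N^2/2\}$. An $n$ partition $\mathcal{A}$ of $[Nn]$ models a tournament $R$ on $[n]$ when $R[\mathcal{A}] = R$. $N_n$ denotes the smallest positive integer $N$ such that every tournament on $[n]$ can be modeled by an $n$ partition of $[Nn]$. *)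

theory Defs
  imports Complex_Main "HOL-Library.Disjoint_Sets"
begin

definition digraph_on :: "'a set \<Rightarrow> 'a rel \<Rightarrow> bool" where
  "digraph_on I R \<longleftrightarrow> finite I \<and> I \<noteq> {} \<and> R \<subseteq> I \<times> I \<and> R \<inter> R\<inverse> = {}"

definition tournament_on :: "'a set \<Rightarrow> 'a rel \<Rightarrow> bool" where
  "tournament_on I R \<longleftrightarrow> digraph_on I R \<and>
     (\<forall>i\<in>I. \<forall>j\<in>I. i \<noteq> j \<longrightarrow> ((i, j) \<in> R) \<noteq> ((j, i) \<in> R))"

text \<open>A family \<open>A\<^sub>1, \<dots>, A\<^sub>n\<close> is a function \<open>A\<close> on the naturals of which only the values
  at the indices \<open>1, \<dots>, n\<close> matter; \<open>N\<close> is the common size of the blocks.\<close>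

definition n_partition :: "nat \<Rightarrow> nat \<Rightarrow> (nat \<Rightarrow> nat set) \<Rightarrow> bool" where
  "n_partition n N A \<longleftrightarrow> disjoint_family_on A {1..n} \<and> (\<Union>i\<in>{1..n}. A i) = {1..N * n} \<and>
     (\<forall>i\<in>{1..n}. card (A i) = N)"

definition partition_digraph :: "nat \<Rightarrow> nat \<Rightarrow> (nat \<Rightarrow> nat set) \<Rightarrow> nat rel" where
  "partition_digraph n N A =
     {(i, j) \<in> {1..n} \<times> {1..n}. real (card {(a, b) \<in> A i \<times> A j. a > b}) > (real N)\<^sup>2 / 2}"

definition models :: "nat \<Rightarrow> nat \<Rightarrow> (nat \<Rightarrow> nat set) \<Rightarrow> nat rel \<Rightarrow> bool" where
  "models n N A R \<longleftrightarrow> n_partition n N A \<and> partition_digraph n N A = R"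

text \<open>\<open>min_block_size n\<close> is the number written \<open>N\<^sub>n\<close>. \<open>LEAST\<close> is unspecified when no
  witness exists, so this is meaningful only together with the existence of some such \<open>N\<close>.\<close>

definition min_block_size :: "nat \<Rightarrow> nat" where
  "min_block_size n =
     (LEAST N. 0 < N \<and> (\<forall>R. tournament_on {1..n} R \<longrightarrow> (\<exists>A. models n N A R)))"

end

theory Submission
  imports Defs
begin

text \<open>Induction on \<open>n\<close>, tripling the block size at each step. Read a partition as a word \<open>w\<close> in which
  every letter \<open>i\<close> occurs \<open>N\<close> times. To add a vertex \<open>x\<close>, let \<open>W\<close> be the set of letters that \<open>x\<close> has
  to beat and \<open>L\<close> the set of the others, and take the word
  \<open>w\<^sub>L w\<^sub>W w\<^sub>W x\<^sup>3\<^sup>N w\<^sub>L w\<close>, with subscripts denoting restriction to a set of letters. Two letters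
  of the same class see three copies of \<open>w\<close>, so that \<open>p\<close> wins become \<open>3N\<^sup>2 + 3p\<close> of \<open>9N\<^sup>2\<close>; two
  letters of different classes share only the last copy, and the other comparisons of copies split
  evenly, so that \<open>p\<close> wins become \<open>4N\<^sup>2 + p\<close>. In both cases the majority is
  preserved. The letter \<open>x\<close> exceeds \<open>2N\<close> of the \<open>3N\<close> copies of each letter in \<open>W\<close> and \<open>N\<close> of those of
  each letter in \<open>L\<close>.\<close>

section \<open>Counting comparisons between blocks\<close>

definition wins :: "nat set \<Rightarrow> nat set \<Rightarrow> nat" where
  "wins S T = card {(a, b) \<in> S \<times> T. a > b}"

lemma wins_eq_sum:
  assumes "finite S" "finite T"
  shows "wins S T = (\<Sum>a\<in>S. \<Sum>b\<in>T. if b < a then 1 else 0)"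
proof -
  have "{(a, b) \<in> S \<times> T. a > b} = Sigma S (\<lambda>a. {b \<in> T. b < a})"
    by auto
  then show ?thesis
    using assms by (simp add: wins_def sum.If_cases Int_def)
qed

lemma wins_add_wins_swap:
  assumes "finite S" "finite T" "S \<inter> T = {}"
  shows "wins S T + wins T S = card S * card T"
proof -
  have "wins T S = (\<Sum>a\<in>S. \<Sum>b\<in>T. if a < b then 1 else 0)"
    using assms by (subst sum.swap) (simp add: wins_eq_sum)
  then have "wins S T + wins T S = (\<Sum>a\<in>S. \<Sum>b\<in>T. (if b < a then 1 else 0) + (if a < b then 1 else 0))"
    using assms by (simp add: wins_eq_sum sum.distrib)
  also have "\<dots> = (\<Sum>a\<in>S. \<Sum>b\<in>T. 1)"
    using assms(3) by (intro sum.cong refl) (auto simp: disjoint_iff not_less_iff_gr_or_eq)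
  finally show ?thesis
    by simp
qed

text \<open>Swapping the coordinates of a pair reverses its comparison. This keeps loops out of
  \<open>partition_digraph\<close>.\<close>

lemma wins_self_le:
  assumes "finite S"
  shows "2 * wins S S \<le> (card S)\<^sup>2"
proof -
  have "wins S S = (\<Sum>a\<in>S. \<Sum>b\<in>S. if a < b then 1 else 0)"
    using assms by (subst sum.swap) (simp add: wins_eq_sum)
  then have "2 * wins S S = (\<Sum>a\<in>S. \<Sum>b\<in>S. (if b < a then 1 else 0) + (if a < b then 1 else 0))"
    using assms by (simp add: wins_eq_sum sum.distrib)
  also have "\<dots> \<le> (\<Sum>a\<in>S. \<Sum>b\<in>S. 1)"
    by (intro sum_mono) auto
  finally show ?thesis
    by (simp add: power2_eq_square)
qed

lemma wins_image_strict_mono: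
  assumes "strict_mono_on U f" "S \<subseteq> U" "T \<subseteq> U"
  shows "wins (f ` S) (f ` T) = wins S T"
proof -
  have less: "f b < f a \<longleftrightarrow> b < a" if "a \<in> U" "b \<in> U" for a b
    using strict_mono_on_less[OF assms(1)] that by blast
  have inj: "inj_on f U"
    using assms(1) by (rule strict_mono_on_imp_inj_on)
  have "{(a, b) \<in> f ` S \<times> f ` T. a > b} = map_prod f f ` {(a, b) \<in> S \<times> T. a > b}"
    using assms(2,3) less by (force simp: image_iff subset_iff)
  moreover have "inj_on (map_prod f f) {(a, b) \<in> S \<times> T. a > b}"
    using map_prod_inj_on[OF inj inj] by (rule inj_on_subset) (use assms in auto)
  ultimately show ?thesis
    by (simp add: wins_def card_image)
qed

section \<open>Placing copies of blocks into slots\<close>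

text \<open>For \<open>S\<close> below \<open>M\<close>, slot \<open>k\<close> is the interval of
  length \<open>M\<close> starting at \<open>k * M\<close>, and \<open>K\<close> lists the slots
  that receive a copy of \<open>S\<close>.\<close>

definition copies :: "nat \<Rightarrow> nat set \<Rightarrow> nat set \<Rightarrow> nat set" where
  "copies M K S = (\<lambda>(k, a). k * M + a) ` (K \<times> S)"

lemma shift_less_iff:
  fixes a b k l M :: nat
  assumes "a < M" "b < M"
  shows "l * M + b < k * M + a \<longleftrightarrow> l < k \<or> l = k \<and> b < a"
proof -
  have *: "p * M + c < q * M + d" if "p < q" "c < M" for p q c d
  proof -
    have "p * M + c < Suc p * M" using that by simp
    also have "\<dots> \<le> q * M" using that by (intro mult_le_mono1) simp
    finally show ?thesis by simp
  qed
  show ?thesis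
    using *[of l k b a] *[of k l a b] assms by (cases k l rule: linorder_cases) auto
qed

lemma shift_eq_iff:
  fixes a b k l M :: nat
  assumes "a < M" "b < M"
  shows "l * M + b = k * M + a \<longleftrightarrow> l = k \<and> b = a"
  using shift_less_iff[OF assms, of l k] shift_less_iff[OF assms(2,1), of k l]
  by (auto simp: linorder_neq_iff)

lemma inj_on_shift:
  fixes K S :: "nat set"
  assumes "S \<subseteq> {..<M}"
  shows "inj_on (\<lambda>(k, a). k * M + a) (K \<times> S)"
proof (rule inj_onI, clarify)
  fix k a l b
  assume "a \<in> S" "b \<in> S" "k * M + a = l * M + b"
  then show "k = l \<and> a = b"
    using assms shift_eq_iff[of b M a k l] by auto
qed

lemma sum_copies:
  assumes "S \<subseteq> {..<M}"
  shows "(\<Sum>x\<in>copies M K S. f x) = (\<Sum>k\<in>K. \<Sum>a\<in>S. f (k * M + a))"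
  unfolding copies_def sum.reindex[OF inj_on_shift[OF assms]]
  by (simp add: sum.cartesian_product case_prod_beta')

lemma finite_copies [simp]: "finite K \<Longrightarrow> finite S \<Longrightarrow> finite (copies M K S)"
  by (simp add: copies_def)

lemma card_copies:
  assumes "S \<subseteq> {..<M}"
  shows "card (copies M K S) = card K * card S"
  using assms by (simp add: copies_def card_image inj_on_shift card_cartesian_product)

lemma copies_disjoint:
  assumes "S \<subseteq> {..<M}" "T \<subseteq> {..<M}" "K \<inter> L = {} \<or> S \<inter> T = {}"
  shows "copies M K S \<inter> copies M L T = {}"
  using assms by (auto simp: copies_def disjoint_iff shift_eq_iff subset_iff)

text \<open>Positions in different slots compare as their slots do, so a winning pair of slots
  contributes all pairs of positions; a shared slot repeats the comparison of \<open>S\<close> with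
  \<open>T\<close>.\<close>

lemma wins_copies:
  assumes S: "S \<subseteq> {..<M}" and T: "T \<subseteq> {..<M}" and "finite K" "finite L"
  shows "wins (copies M K S) (copies M L T)
    = wins K L * (card S * card T) + card (K \<inter> L) * wins S T"
proof -
  have fin: "finite S" "finite T"
    using S T by (auto intro: finite_subset)
  let ?c = "\<lambda>k a l b. if l * M + b < k * M + a then 1 else 0 :: nat"
  have pair: "(\<Sum>a\<in>S. \<Sum>b\<in>T. ?c k a l b)
      = (if l < k then 1 else 0) * (card S * card T) + (if l = k then 1 else 0) * wins S T" for k l
  proof -
    have "(\<Sum>a\<in>S. \<Sum>b\<in>T. ?c k a l b)
      = (\<Sum>a\<in>S. \<Sum>b\<in>T. (if l < k then 1 else 0) + (if l = k then 1 else 0) * (if b < a then 1 else 0))"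
      using S T by (intro sum.cong refl) (auto simp: shift_less_iff subset_iff)
    then show ?thesis
      using fin by (simp add: sum.distrib wins_eq_sum)
  qed
  have "wins (copies M K S) (copies M L T) = (\<Sum>k\<in>K. \<Sum>a\<in>S. \<Sum>l\<in>L. \<Sum>b\<in>T. ?c k a l b)"
    using assms fin
    by (simp add: wins_eq_sum sum_copies)
  also have "\<dots> = (\<Sum>k\<in>K. \<Sum>l\<in>L. \<Sum>a\<in>S. \<Sum>b\<in>T. ?c k a l b)"
    by (intro sum.cong refl sum.swap)
  also have "\<dots> = (\<Sum>k\<in>K. \<Sum>l\<in>L. if l < k then 1 else 0) * (card S * card T)
      + (\<Sum>k\<in>K. \<Sum>l\<in>L. if l = k then 1 else 0) * wins S T"
    by (simp only: pair sum.distrib flip: sum_distrib_right)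
  also have "(\<Sum>k\<in>K. \<Sum>l\<in>L. if l = k then 1 else 0 :: nat) = card (K \<inter> L)"
    using assms by (simp add: sum.If_cases Int_def)
  finally show ?thesis
    using assms by (simp add: wins_eq_sum)
qed

text \<open>Dropping the requirement that the blocks exhaust an initial segment avoids renumbering in the
  induction; \<open>realizes_imp_n_partition\<close> compresses them once at the end.\<close>

definition realizes :: "'i set \<Rightarrow> nat \<Rightarrow> 'i rel \<Rightarrow> ('i \<Rightarrow> nat set) \<Rightarrow> bool" where
  "realizes I N R A \<longleftrightarrow> disjoint_family_on A I \<and> (\<forall>i\<in>I. finite (A i) \<and> card (A i) = N) \<and>
     (\<forall>i\<in>I. \<forall>j\<in>I. (i, j) \<in> R \<longrightarrow> N\<^sup>2 < 2 * wins (A i) (A j))"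

section \<open>Adding a vertex\<close>

text \<open>The six factors of the word occupy slots 0 to 5: letters of \<open>W\<close> occur in 1,
  2, 5, letters of \<open>L\<close> in 0, 4, 5, and the new letter in 3.\<close>

lemma wins_positions:
  "wins {1, 2, 5} {1, 2, 5} = 3" "wins {0, 4, 5} {0, 4, 5} = 3"
  "wins {1, 2, 5} {0, 4, 5} = 4" "wins {0, 4, 5} {1, 2, 5} = 4"
  "wins {3} {1, 2, 5} = 2" "wins {0, 4, 5} {3} = 2"
  by (simp_all add: wins_eq_sum)

lemma realizes_insert:
  assumes A: "realizes I N R A" and fin: "finite I" and x: "x \<notin> I" and N: "0 < N"
    and tour: "tournament_on (insert x I) R"
  shows "\<exists>B. realizes (insert x I) (3 * N) R B"
proof -
  have finA: "finite (A i)" and cardA: "card (A i) = N" if "i \<in> I" for i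
    using A that by (auto simp: realizes_def)
  have winsA: "N\<^sup>2 < 2 * wins (A i) (A j)" if "i \<in> I" "j \<in> I" "(i, j) \<in> R" for i j
    using A that by (auto simp: realizes_def)
  have disjA: "A i \<inter> A j = {}" if "i \<in> I" "j \<in> I" "i \<noteq> j" for i j
    using A that by (auto simp: realizes_def disjoint_family_on_def)
  have asym: "(j, i) \<notin> R" if "(i, j) \<in> R" for i j
    using tour that by (auto simp: tournament_on_def digraph_on_def)
  have "finite ((\<Union>i\<in>I. A i) \<union> {..<3 * N})"
    using fin finA by auto
  \<comment> \<open>One slot must also hold all \<open>3 * N\<close> positions of the new
    letter.\<close>
  then obtain M where M: "(\<Union>i\<in>I. A i) \<union> {..<3 * N} \<subseteq> {..<M}"
    unfolding finite_nat_set_iff_bounded by blast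
  then have sub: "A i \<subseteq> {..<M}" if "i \<in> I" for i
    using that by auto
  have subx: "{..<3 * N} \<subseteq> {..<M}"
    using M by auto
  define K :: "'a \<Rightarrow> nat set" where "K i = (if (x, i) \<in> R then {1, 2, 5} else {0, 4, 5})" for i
  define B where "B i = (if i = x then copies M {3} {..<3 * N} else copies M (K i) (A i))" for i
  have Bx: "B x = copies M {3} {..<3 * N}"
    by (simp add: B_def)
  have BI: "B i = copies M (K i) (A i)" if "i \<in> I" for i
    using that x by (auto simp: B_def)
  have finK [simp]: "finite (K i)" for i
    by (simp add: K_def)
  have cardK: "card (K i) = 3" for i
    by (simp add: K_def)
  have K3: "{3} \<inter> K i = {}" "K i \<inter> {3} = {}" for i
    by (auto simp: K_def)
  have "B i \<inter> B j = {}" if ij: "i \<in> insert x I" "j \<in> insert x I" "i \<noteq> j" for i j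
  proof -
    consider "i = x" "j \<in> I" | "i \<in> I" "j = x" | "i \<in> I" "j \<in> I"
      using ij by auto
    then show ?thesis
      by cases (use ij sub subx disjA K3 in \<open>simp_all add: Bx BI copies_disjoint\<close>)
  qed
  then have disj: "disjoint_family_on B (insert x I)"
    by (auto simp: disjoint_family_on_def)
  have size: "finite (B i) \<and> card (B i) = 3 * N" if "i \<in> insert x I" for i
    using that sub subx finA cardA by (auto simp: Bx BI card_copies cardK)
  have "(3 * N)\<^sup>2 < 2 * wins (B i) (B j)" if ij: "i \<in> insert x I" "j \<in> insert x I" "(i, j) \<in> R" for i j
  proof -
    consider "i = x" "j \<in> I" | "i \<in> I" "j = x" | "i \<in> I" "j \<in> I"
      using ij asym by auto
    then show ?thesis
    proof cases
      case 1
      \<comment> \<open>Two of three slots are won, so the doubled count is 12 against 9 times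
        \<open>N\<^sup>2\<close>.\<close>
      then have "wins (B i) (B j) = 2 * (3 * N * N)"
        using ij sub subx cardA by (simp add: Bx BI wins_copies K3 K_def wins_positions del: One_nat_def)
      then show ?thesis
        using N by (simp add: power2_eq_square)
    next
      case 2
      then have "wins (B i) (B j) = 2 * (N * (3 * N))"
        using ij asym sub subx cardA by (simp add: Bx BI wins_copies K3 K_def wins_positions del: One_nat_def)
      then show ?thesis
        using N by (simp add: power2_eq_square)
    next
      case 3
      have same: "card (K i \<inter> K j) = (if K i = K j then 3 else 1)"
        by (auto simp: K_def)
      have "wins (K i) (K j) = (if K i = K j then 3 else 4)"
        by (auto simp: K_def wins_positions simp del: One_nat_def)
      \<comment> \<open>Doubled and compared with \<open>9 * N\<^sup>2\<close>, either value reduces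
        to the old majority \<open>N\<^sup>2 < 2 * wins (A i) (A j)\<close>.\<close>
      then have "wins (B i) (B j) = (if K i = K j then 3 * N\<^sup>2 + 3 * wins (A i) (A j)
          else 4 * N\<^sup>2 + wins (A i) (A j))"
        using 3 sub cardA same by (simp add: BI wins_copies power2_eq_square)
      then show ?thesis
        using winsA[OF 3 ij(3)] by (simp add: power_mult_distrib)
    qed
  qed
  with disj size have "realizes (insert x I) (3 * N) R B"
    by (simp add: realizes_def)
  then show ?thesis
    by blast
qed

lemma tournament_on_subset:
  assumes "tournament_on J R" "I \<subseteq> J" "I \<noteq> {}"
  shows "tournament_on I (R \<inter> I \<times> I)"
  using assms unfolding tournament_on_def digraph_on_def
  by (intro conjI; (blast intro: finite_subset)?)

lemma exists_realizes:
  assumes "tournament_on {1..m + 2} R"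
  shows "\<exists>A. realizes {1..m + 2} (3 ^ m) R A"
  using assms
proof (induction m arbitrary: R)
  case 0
  have "{1..0 + 2} = {1, 2 :: nat}"
    by auto
  moreover have "R \<inter> R\<inverse> = {}"
    using 0 by (simp add: tournament_on_def digraph_on_def)
  moreover have "wins {2} {1} = 1" "wins {3} {2} = 1"
    by (simp_all add: wins_eq_sum)
  \<comment> \<open>Vertex 2 sits at position 2, and vertex 1 just above or just below it, as its
    arc demands.\<close>
  ultimately have "realizes {1..0 + 2} (3 ^ 0) R
      (\<lambda>i. if i = 2 then {2} else if (1, 2) \<in> R then {3} else {1})"
    by (auto simp: realizes_def disjoint_family_on_def)
  then show ?case
    by blast
next
  case (Suc m)
  let ?I = "{1..m + 2}"
  have ins: "{1..Suc m + 2} = insert (m + 3) ?I"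
    by auto
  have "tournament_on ?I (R \<inter> ?I \<times> ?I)"
    using Suc.prems by (rule tournament_on_subset) auto
  then obtain A where "realizes ?I (3 ^ m) (R \<inter> ?I \<times> ?I) A"
    using Suc.IH by blast
  \<comment> \<open>\<open>realizes\<close> tests \<open>R\<close> only on pairs from its index
    set.\<close>
  then have "realizes ?I (3 ^ m) R A"
    by (auto simp: realizes_def)
  then have "\<exists>B. realizes (insert (m + 3) ?I) (3 * 3 ^ m) R B"
    by (rule realizes_insert) (use Suc.prems in \<open>simp_all only: ins[symmetric], auto\<close>)
  then show ?case
    by (simp only: ins power_Suc)
qed

section \<open>Compression to an initial segment\<close>

text \<open>The rank of \<open>a\<close> is the number of elements of \<open>U\<close> up to
  \<open>a\<close>. Ranks are distinct and lie in \<open>{1..card U}\<close>, so they fill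
  it.\<close>

lemma rank_image:
  fixes U :: "nat set"
  assumes "finite U"
  obtains r where "strict_mono_on U r" "r ` U = {1..card U}"
proof
  define r where "r a = card {u \<in> U. u \<le> a}" for a
  show mono: "strict_mono_on U r"
  proof (rule strict_mono_onI)
    fix a b
    assume "a \<in> U" "b \<in> U" "a < b"
    then have "{u \<in> U. u \<le> a} \<subset> {u \<in> U. u \<le> b}"
      by (auto simp: psubset_eq set_eq_iff not_le intro!: exI[of _ b])
    then show "r a < r b"
      unfolding r_def using assms by (intro psubset_card_mono) auto
  qed
  have "r ` U \<subseteq> {1..card U}"
    using assms by (auto simp: r_def Suc_le_eq card_gt_0_iff intro!: card_mono)
  moreover have "card (r ` U) = card U"
    using mono by (simp add: card_image strict_mono_on_imp_inj_on)
  ultimately show "r ` U = {1..card U}"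
    by (intro card_subset_eq) auto
qed

text \<open>\<open>realizes\<close> only asks that arcs of \<open>R\<close> win. Nothing else can:
  disjoint blocks share \<open>N\<^sup>2\<close> comparisons, so two opposite majorities are
  impossible, and of two distinct vertices one beats the other in \<open>R\<close>.\<close>

lemma realizes_imp_partition_digraph:
  assumes tour: "tournament_on {1..n} R" and A: "realizes {1..n} N R A"
  shows "partition_digraph n N A = R"
proof -
  have R: "R \<subseteq> {1..n} \<times> {1..n}"
    using tour by (simp add: tournament_on_def digraph_on_def)
  have iff: "real (card {(a, b) \<in> A i \<times> A j. a > b}) > (real N)\<^sup>2 / 2 \<longleftrightarrow> N\<^sup>2 < 2 * wins (A i) (A j)"
    for i j
  proof -
    have "N\<^sup>2 < 2 * wins (A i) (A j) \<longleftrightarrow> real (N\<^sup>2) < real (2 * wins (A i) (A j))"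
      by (simp only: of_nat_less_iff)
    then show ?thesis
      by (auto simp: wins_def)
  qed
  have "N\<^sup>2 < 2 * wins (A i) (A j) \<longleftrightarrow> (i, j) \<in> R" if ij: "i \<in> {1..n}" "j \<in> {1..n}" for i j
  proof
    assume win: "N\<^sup>2 < 2 * wins (A i) (A j)"
    have fin: "finite (A i)" "finite (A j)" and N: "card (A i) = N" "card (A j) = N"
      using A ij by (simp_all add: realizes_def)
    have "i \<noteq> j"
      using wins_self_le[OF fin(1)] win N by auto
    then have "A i \<inter> A j = {}"
      using A ij by (simp add: realizes_def disjoint_family_on_def)
    then have "wins (A i) (A j) + wins (A j) (A i) = N\<^sup>2"
      using fin N by (simp add: wins_add_wins_swap power2_eq_square)
    moreover have "N\<^sup>2 < 2 * wins (A j) (A i)" if "(j, i) \<in> R"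
      using A ij that by (simp add: realizes_def)
    ultimately have "(j, i) \<notin> R"
      using win by linarith
    then show "(i, j) \<in> R"
      using tour ij \<open>i \<noteq> j\<close> unfolding tournament_on_def by blast
  next
    assume "(i, j) \<in> R"
    then show "N\<^sup>2 < 2 * wins (A i) (A j)"
      using A ij by (simp add: realizes_def)
  qed
  then show ?thesis
    unfolding partition_digraph_def iff using R by blast
qed

text \<open>Replacing positions by their ranks in the union closes the gaps and preserves every
  comparison.\<close>

lemma realizes_imp_n_partition:
  assumes "realizes {1..n} N R A"
  shows "\<exists>B. n_partition n N B \<and> realizes {1..n} N R B"
proof -
  let ?U = "\<Union>i\<in>{1..n}. A i"
  have fin: "finite (A i)" and card: "card (A i) = N" if "i \<in> {1..n}" for i
    using assms that by (auto simp: realizes_def)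
  have disj: "disjoint_family_on A {1..n}"
    using assms by (simp add: realizes_def)
  have "finite ?U"
    using fin by auto
  then obtain r where r: "strict_mono_on ?U r" "r ` ?U = {1..card ?U}"
    by (rule rank_image)
  have cardU: "card ?U = N * n"
    using disj fin card by (subst card_UN_disjoint') auto
  have sub: "A i \<subseteq> ?U" if "i \<in> {1..n}" for i
    using that by auto
  have inj: "inj_on r ?U"
    using r(1) by (rule strict_mono_on_imp_inj_on)
  have "r ` A i \<inter> r ` A j = {}" if "i \<in> {1..n}" "j \<in> {1..n}" "i \<noteq> j" for i j
    using inj_on_image_Int[OF inj sub[OF that(1)] sub[OF that(2)]] disj that
    by (auto simp: disjoint_family_on_def)
  then have disj': "disjoint_family_on (\<lambda>i. r ` A i) {1..n}"
    by (auto simp: disjoint_family_on_def)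
  have card': "card (r ` A i) = N" if "i \<in> {1..n}" for i
    using card_image[OF inj_on_subset[OF inj sub[OF that]]] card that by simp
  have "n_partition n N (\<lambda>i. r ` A i)"
    using disj' card' r(2) cardU by (simp add: n_partition_def image_UN)
  moreover have "realizes {1..n} N R (\<lambda>i. r ` A i)"
    using assms disj' card' fin wins_image_strict_mono[OF r(1) sub sub] by (simp add: realizes_def)
  ultimately show ?thesis
    by blast
qed

theorem theorem1p2:
  fixes n :: nat
  assumes "n \<ge> 2"
  shows "(\<forall>R. tournament_on {1..n} R \<longrightarrow>
            (\<exists>A. n_partition n (3 ^ (n - 2)) A \<and> R = partition_digraph n (3 ^ (n - 2)) A)) \<and>
         min_block_size n \<le> 3 ^ (n - 2)"
proof
  have "\<exists>A. n_partition n (3 ^ (n - 2)) A \<and> R = partition_digraph n (3 ^ (n - 2)) A"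
    if R: "tournament_on {1..n} R" for R
  proof -
    have "\<exists>A. realizes {1..n} (3 ^ (n - 2)) R A"
      using exists_realizes[of "n - 2" R] R assms by (metis le_add_diff_inverse2)
    then show ?thesis
      using realizes_imp_n_partition realizes_imp_partition_digraph[OF R] by metis
  qed
  then show *: "\<forall>R. tournament_on {1..n} R \<longrightarrow>
      (\<exists>A. n_partition n (3 ^ (n - 2)) A \<and> R = partition_digraph n (3 ^ (n - 2)) A)"
    by blast
  show "min_block_size n \<le> 3 ^ (n - 2)"
    unfolding min_block_size_def
  \<comment> \<open>The first conjunct makes \<open>3 ^ (n - 2)\<close> a witness for the
    \<open>LEAST\<close> predicate, which is therefore satisfiable.\<close>
  proof (rule Least_le, intro conjI)
    show "\<forall>R. tournament_on {1..n} R \<longrightarrow> (\<exists>A. models n (3 ^ (n - 2)) A R)"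
      using * unfolding models_def by metis
  qed simp
qed

end
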